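(* Let $\mathcal S$ be a highly underactuated balance system, with $n$ actuated and $m>n$ unactuated coordinates, $m=kn+z$. If $\mathcal S$ can be written in the cascaded (CEIC) form $\mathcal S\equiv\{\mathcal S_a^0,\mathcal S_a^1,\dots,\mathcal S_a^k,\mathcal S^{k+1}\}$ described in the context (the system being subject to the standing conditions listed there), then under the control input $u=u_i^{\mathrm{int}}$ the closed-loop dynamics of $\mathcal S^i$ becomes $$\ddot q_a^{(j)}=v_j^{\mathrm{int}},\quad i\le j\le k,\qquad \ddot q^{(k+1)}=v_{k+1}^{\mathrm{int}}.$$
   Context: **System.** $q=[q_a^T\ q_u^T]^T\in\mathbb R^{n+m}$, $q_a\in\mathbb R^n$ (actuated), $q_u\in\mathbb R^m$ (unactuated), input $u\in\mathbb R^n$. The dynamics $\mathcal S$ are $$D_{aa}\ddot q_a+D_{au}\ddot q_u+H_a=u,\qquad D_{ua}\ddot q_a+D_{uu}\ddot q_u+H_u=0,$$ where $D(q)$ is the inertia matrix with blocks $D_{aa},D_{au},D_{ua},D_{uu}$, and $H=[H_a^T\ H_u^T]^T$ collects the Coriolis and gravity terms and depends on $(q,\dot q)$. "Highly underactuated" means $n<m$. Write $m=kn+z$: there are $k$ subsystems with $n$ coordinates each, and a last, fully actuated one with the remaining $z\le n$ coordinates. **Cascaded (CEIC) form.** Set $q^{(0)}=q$, $q_a^{(0)}=q_a$, $q_u^{(0)}=q_u$, $D^{(0)}=D$, $H^{(0)}=H$, $B^{(0)}=[I_n\ \ 0]^T$, $\mathcal S^0=\mathcal S$. For $0\le l\le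 k$, given $\mathcal S^l:\ D^{(l)}\ddot q^{(l)}+H^{(l)}=B^{(l)}u$, split $q^{(l)}=[(q_a^{(l)})^T\ (q_u^{(l)})^T]^T$ with $q_a^{(l)}$ the first $n$ components, and split $D^{(l)}$ (into $D^{(l)}_{aa},D^{(l)}_{au},D^{(l)}_{ua},D^{(l)}_{uu}$), $H^{(l)}$ (into $H^{(l)}_a,H^{(l)}_u$) and $B^{(l)}$ (into $B_a^{(l)}\in\mathbb R^{n\times n}$ and $B_u^{(l)}$) conformally. The subsystem $\mathcal S_a^l$ is the first block row $$\mathcal S_a^l:\ D_{aa}^{(l)}\ddot q_a^{(l)}+D_{au}^{(l)}\ddot q_u^{(l)}+H_a^{(l)}=B_a^{(l)}u .$$ Eliminating $\ddot q_a^{(l)}$ from the second block row gives $\mathcal S^{l+1}:\ D^{(l+1)}\ddot q^{(l+1)}+H^{(l+1)}=B^{(l+1)}u$ with $q^{(l+1)}=q_u^{(l)}$ and $$D^{(l+1)}=D_{uu}^{(l)}-D_{ua}^{(l)}(D_{aa}^{(l)})^{-1}D_{au}^{(l)},\quad H^{(l+1)}=H_u^{(l)}-D_{ua}^{(l)}(D_{aa}^{(l)})^{-1}H_a^{(l)},\quad B^{(l+1)}=B_u^{(l)}-D_{ua}^{(l)}(D_{aa}^{(l)})^{-1}B_a^{(l)}.$$ Thus $\mathcal S^l=\{\mathcal S_a^l,\mathcal S^{l+1}\}$. The last system $\mathcal S^{k+1}$ has coordinates $q^{(k+1)}\in\mathbb R^z$; by convention $\mathcal S_a^{k+1}=\mathcal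 S^{k+1}$, $q_a^{(k+1)}=q^{(k+1)}$, $D_{aa}^{(k+1)}=D^{(k+1)}$, $B_a^{(k+1)}=B^{(k+1)}$, $H_a^{(k+1)}=H^{(k+1)}$, and terms $D_{au}^{(k+1)}\ddot q_u^{(k+1)}$ are absent. Since $q_u^{(l)}$ is composed of $q_a^{(l+1)},\dots,q_a^{(k)},q^{(k+1)}$, write $D_{au}^{(l)}=[D_{au,l+1}^{(l)}\ \cdots\ D_{au,k+1}^{(l)}]$, so $D_{au}^{(l)}\ddot q_u^{(l)}=\sum_{j=l}^{k}D_{au,j+1}^{(l)}\ddot q_a^{(j+1)}$. **Standing conditions imposed on the system for this design.** - $\operatorname{rank}(D_{aa}^{(l)})=\operatorname{rank}(D_{au}^{(l)})=\operatorname{rank}(B_a^{(l)})=n$ for $l\le k$, and $\operatorname{rank}(D_{aa}^{(k+1)})=\operatorname{rank}(B_a^{(k+1)})=z$; - $D_{aa}^{(l+1)}-B_a^{(l+1)}\big(B_a^{(l)}\big)^{-1}D_{au,l+1}^{(l)}\neq 0$ for each $l\le k$. **Preliminary controls and reference profiles.** Let $q_a^{(0),d}(t)$ be the given desired trajectory for $q_a^{(0)}$, and let $a_l,b_l$ be gain matrices ($n\times n$ for $l\le k$, $z\times z$ for $l=k+1$). For $0\le l\le k$, $$u_l^{\mathrm{ext}}=(B_a^{(l)})^{-1}\big(D_{aa}^{(l)}v_l^{\mathrm{ext}}+D_{au}^{(l)}\ddot q_u^{(l)}+H_a^{(l)}\big),$$ with $v_0^{\mathrm{ext}}=\ddot q_a^{(0),d}-a_0e_0-b_0\dot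 e_0$, $e_0=q_a^{(0)}-q_a^{(0),d}$, and, for $l\ge1$, $v_l^{\mathrm{ext}}=\ddot q_a^{(l),e}-a_le_l-b_l\dot e_l$, $e_l=q_a^{(l)}-q_a^{(l),e}$. Here, for $0\le l\le k$, $q_a^{(l+1),e}$ is the balance equilibrium: the value of $q_a^{(l+1)}$ solving $$D_{aa}^{(l+1)}\ddot q_a^{(l+1)}+D_{au}^{(l+1)}\ddot q_u^{(l+1)}+H_a^{(l+1)}-B_a^{(l+1)}u_l^{\mathrm{ext}}=0\quad\text{with }\dot q_a^{(l+1)}=\ddot q_a^{(l+1)}=0 .$$ Write $q^{(k+1),e}=q_a^{(k+1),e}$ and $e_{k+1}=q^{(k+1)}-q^{(k+1),e}$. **Final (updated) controls.** With $(\cdot)^+$ the generalized (Moore–Penrose) inverse, $$v_{k+1}^{\mathrm{int}}=\ddot q^{(k+1),e}-a_{k+1}e_{k+1}-b_{k+1}\dot e_{k+1},\qquad u_{k+1}^{\mathrm{int}}=(B^{(k+1)})^{+}\big(D^{(k+1)}v_{k+1}^{\mathrm{int}}+H^{(k+1)}\big),$$ and recursively for $l=k,k-1,\dots,0$, $$v_l^{\mathrm{int}}=(D_{aa}^{(l)})^{-1}\Big(B_a^{(l)}u_{l+1}^{\mathrm{int}}-D_{au,l+1}^{(l)}v_{l+1}^{\mathrm{int}}-\sum_{j=l+1}^{k}D_{au,j+1}^{(l)}\ddot q_a^{(j+1)}-H_a^{(l)}\Big),$$ $$u_l^{\mathrm{int}}=(B_a^{(l)})^{-1}\big(D_{aa}^{(l)}v_l^{\mathrm{int}}+D_{au}^{(l)}\ddot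 q_u^{(l)}+H_a^{(l)}\big),$$ where the accelerations $\ddot q$ in these formulas are the actual accelerations along the trajectory.
   Formalization: The condition that the coupling matrix D_aa^(l+1) − B_a^(l+1)(B_a^(l))^{-1}D_{au,l+1}^(l) be ≠ 0 is taken to mean nonsingular (the claim fails if it is merely a nonzero matrix); the rank of D_au^(l) is required only to be full, so z < n is allowed. *)

theory Defs
  imports
    "HOL-Analysis.Derivative"
    "Jordan_Normal_Form.DL_Rank"
    "Jordan_Normal_Form.Gauss_Jordan_Elimination"
begin

unbundle no vec_syntax
hide_const (open) Finite_Cartesian_Product.vec
hide_type (open) Finite_Cartesian_Product.vec

text \<open>
  The block sizes vary with the level of the cascade, so vectors and matrices are those of
  Jordan\_Normal\_Form, whose dimensions are explicit.
\<close>

section \<open>Matrices and curves\<close>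

definition minv :: "real mat \<Rightarrow> real mat" where
  "minv A = the (mat_inverse A)"

definition mrank :: "real mat \<Rightarrow> nat" where
  "mrank A = vec_space.rank (dim_row A) A"

definition is_mp_inverse :: "real mat \<Rightarrow> real mat \<Rightarrow> bool" where
  "is_mp_inverse A X \<longleftrightarrow> X \<in> carrier_mat (dim_col A) (dim_row A)
     \<and> A * X * A = A \<and> X * A * X = X
     \<and> transpose_mat (A * X) = A * X \<and> transpose_mat (X * A) = X * A"

definition mp_inverse :: "real mat \<Rightarrow> real mat" where
  "mp_inverse A = (THE X. is_mp_inverse A X)"

definition blk11 :: "real mat \<Rightarrow> nat \<Rightarrow> nat \<Rightarrow> real mat" where
  "blk11 A r c = (case split_block A r c of (A11, A12, A21, A22) \<Rightarrow> A11)"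

definition blk12 :: "real mat \<Rightarrow> nat \<Rightarrow> nat \<Rightarrow> real mat" where
  "blk12 A r c = (case split_block A r c of (A11, A12, A21, A22) \<Rightarrow> A12)"

definition blk21 :: "real mat \<Rightarrow> nat \<Rightarrow> nat \<Rightarrow> real mat" where
  "blk21 A r c = (case split_block A r c of (A11, A12, A21, A22) \<Rightarrow> A21)"

definition blk22 :: "real mat \<Rightarrow> nat \<Rightarrow> nat \<Rightarrow> real mat" where
  "blk22 A r c = (case split_block A r c of (A11, A12, A21, A22) \<Rightarrow> A22)"

text \<open>Componentwise time derivative on the time set \<open>T\<close> (one-sided at an end point of \<open>T\<close>).\<close>

definition ddt :: "real set \<Rightarrow> (real \<Rightarrow> real vec) \<Rightarrow> real \<Rightarrow> real vec" where
  "ddt T f t = vec (dim_vec (f t)) (\<lambda>i. vector_derivative (\<lambda>s. f s $ i) (at t within T))"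

definition twice_differentiable_curve :: "real set \<Rightarrow> nat \<Rightarrow> (real \<Rightarrow> real vec) \<Rightarrow> bool" where
  "twice_differentiable_curve T d f \<longleftrightarrow>
     (\<forall>t\<in>T. f t \<in> carrier_vec d \<and>
        (\<forall>i<d. (\<lambda>s. f s $ i) differentiable (at t within T) \<and>
               (\<lambda>s. ddt T f s $ i) differentiable (at t within T)))"

section \<open>The system and its cascade\<close>

text \<open>
  \<open>nact\<close>, \<open>nsub\<close>, \<open>nlast\<close> are $n$, $k$, $z$; there are $m = kn + z$ unactuated coordinates.
  \<open>inertia\<close> is $D(q)$ and \<open>bias\<close> is $H(q, \dot q)$. All conditions on the system are imposed
  on the set \<open>cspace\<close> of admissible configurations, which may be the whole space.
\<close>

record plant =
  nact :: nat
  nsub :: nat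
  nlast :: nat
  cspace :: "real vec set"
  inertia :: "real vec \<Rightarrow> real mat"
  bias :: "real vec \<Rightarrow> real vec \<Rightarrow> real vec"

definition ndof :: "plant \<Rightarrow> nat" where
  "ndof P = nact P + (nsub P * nact P + nlast P)"

definition well_formed_plant :: "plant \<Rightarrow> bool" where
  "well_formed_plant P \<longleftrightarrow> nlast P \<le> nact P
     \<and> cspace P \<subseteq> carrier_vec (ndof P)
     \<and> (\<forall>x\<in>cspace P. inertia P x \<in> carrier_mat (ndof P) (ndof P)
          \<and> (\<forall>y\<in>carrier_vec (ndof P). bias P x y \<in> carrier_vec (ndof P)))"

text \<open>
  Number of entries of $q_a^{(l)}$. With this choice the convention for level $k+1$ needs no
  special case: the first block is then all of $\mathcal S^{k+1}$, and the complementary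
  blocks are empty.
\<close>

definition bsize :: "plant \<Rightarrow> nat \<Rightarrow> nat" where
  "bsize P l = (if l \<le> nsub P then nact P else nlast P)"

text \<open>
  For a vector $w$ with one entry per coordinate (position, velocity or acceleration), the
  entries belonging to $q^{(l)}$, $q_a^{(l)}$, $q_u^{(l)}$.
\<close>

definition ql :: "plant \<Rightarrow> nat \<Rightarrow> real vec \<Rightarrow> real vec" where
  "ql P l w = vec_last w (ndof P - l * nact P)"

definition qa :: "plant \<Rightarrow> nat \<Rightarrow> real vec \<Rightarrow> real vec" where
  "qa P l w = vec_first (ql P l w) (bsize P l)"

definition qu :: "plant \<Rightarrow> nat \<Rightarrow> real vec \<Rightarrow> real vec" where
  "qu P l w = vec_last (ql P l w) (ndof P - l * nact P - bsize P l)"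

definition put_qa :: "plant \<Rightarrow> nat \<Rightarrow> real vec \<Rightarrow> real vec \<Rightarrow> real vec" where
  "put_qa P l w p = vec (dim_vec w)
     (\<lambda>i. if l * nact P \<le> i \<and> i < l * nact P + bsize P l then p $ (i - l * nact P) else w $ i)"

primrec Dl :: "plant \<Rightarrow> nat \<Rightarrow> real vec \<Rightarrow> real mat" where
  "Dl P 0 x = inertia P x"
| "Dl P (Suc l) x =
     (let D = Dl P l x; n = bsize P l
      in blk22 D n n - blk21 D n n * minv (blk11 D n n) * blk12 D n n)"

definition Daa :: "plant \<Rightarrow> nat \<Rightarrow> real vec \<Rightarrow> real mat" where
  "Daa P l x = blk11 (Dl P l x) (bsize P l) (bsize P l)"

definition Dau :: "plant \<Rightarrow> nat \<Rightarrow> real vec \<Rightarrow> real mat" where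
  "Dau P l x = blk12 (Dl P l x) (bsize P l) (bsize P l)"

definition Dua :: "plant \<Rightarrow> nat \<Rightarrow> real vec \<Rightarrow> real mat" where
  "Dua P l x = blk21 (Dl P l x) (bsize P l) (bsize P l)"

text \<open>\<open>Dau_part P l j x\<close> is $D_{au,j}^{(l)}$, the columns of $D_{au}^{(l)}$ multiplying
  $\ddot q_a^{(j)}$, for $l < j \le k+1$.\<close>

definition Dau_part :: "plant \<Rightarrow> nat \<Rightarrow> nat \<Rightarrow> real vec \<Rightarrow> real mat" where
  "Dau_part P l j x = mat (bsize P l) (bsize P j)
     (\<lambda>(r, c). Dau P l x $$ (r, (j - (l + 1)) * nact P + c))"

primrec Hl :: "plant \<Rightarrow> nat \<Rightarrow> real vec \<Rightarrow> real vec \<Rightarrow> real vec" where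
  "Hl P 0 x y = bias P x y"
| "Hl P (Suc l) x y =
     (let H = Hl P l x y; n = bsize P l
      in vec_last H (dim_vec H - n) - Dua P l x * minv (Daa P l x) *\<^sub>v vec_first H n)"

definition Ha :: "plant \<Rightarrow> nat \<Rightarrow> real vec \<Rightarrow> real vec \<Rightarrow> real vec" where
  "Ha P l x y = vec_first (Hl P l x y) (bsize P l)"

primrec Bl :: "plant \<Rightarrow> nat \<Rightarrow> real vec \<Rightarrow> real mat" where
  "Bl P 0 x = 1\<^sub>m (nact P) @\<^sub>r 0\<^sub>m (ndof P - nact P) (nact P)"
| "Bl P (Suc l) x =
     (let B = Bl P l x; n = bsize P l
      in blk21 B n (nact P) - Dua P l x * minv (Daa P l x) * blk11 B n (nact P))"

definition Ba :: "plant \<Rightarrow> nat \<Rightarrow> real vec \<Rightarrow> real mat" where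
  "Ba P l x = blk11 (Bl P l x) (bsize P l) (nact P)"

text \<open>
  The systems $\mathcal S^l$ and, in residual form, $\mathcal S_a^l$, for configuration \<open>x\<close>,
  velocity \<open>y\<close>, acceleration \<open>w\<close> and input \<open>u\<close>.
\<close>

definition sys :: "plant \<Rightarrow> nat \<Rightarrow> real vec \<Rightarrow> real vec \<Rightarrow> real vec \<Rightarrow> real vec \<Rightarrow> bool" where
  "sys P l x y w u \<longleftrightarrow> Dl P l x *\<^sub>v ql P l w + Hl P l x y = Bl P l x *\<^sub>v u"

definition sub_residual ::
    "plant \<Rightarrow> nat \<Rightarrow> real vec \<Rightarrow> real vec \<Rightarrow> real vec \<Rightarrow> real vec \<Rightarrow> real vec" where
  "sub_residual P l x y w u =
     Daa P l x *\<^sub>v qa P l w + Dau P l x *\<^sub>v qu P l w + Ha P l x y - Ba P l x *\<^sub>v u"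

text \<open>
  \<open>Dau P l x\<close> has at least \<open>nact P\<close> columns for $l < k$, so its rank condition there is
  rank $n$; for $l = k$ it has $z \le n$ columns, and the condition is full rank.
  The coupling condition is nonsingularity. For matrix blocks merely being different from
  the zero matrix does not determine the closed loop: if the coupling matrix has a kernel,
  trajectories with $\ddot q_a^{(l+1)} - v_{l+1}$ in that kernel satisfy it too.
\<close>

definition standing_conditions :: "plant \<Rightarrow> bool" where
  "standing_conditions P \<longleftrightarrow> (\<forall>x\<in>cspace P.
     (\<forall>l\<le>nsub P. mrank (Daa P l x) = nact P
        \<and> mrank (Dau P l x) = min (nact P) (dim_col (Dau P l x))
        \<and> mrank (Ba P l x) = nact P)
     \<and> mrank (Daa P (nsub P + 1) x) = nlast P
     \<and> mrank (Ba P (nsub P + 1) x) = nlast P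
     \<and> (\<forall>l\<le>nsub P. det (Daa P (l + 1) x
          - Ba P (l + 1) x * minv (Ba P l x) * Dau_part P l (l + 1) x) \<noteq> 0))"

section \<open>Controls\<close>

text \<open>
  \<open>profile 0\<close> is the desired trajectory $q_a^{(0),d}$ and \<open>profile l\<close>, $1 \le l \le k+1$,
  is the balance equilibrium $q_a^{(l),e}$, as functions of time; \<open>gain_a\<close>, \<open>gain_b\<close> are the
  matrices $a_l$, $b_l$.
\<close>

record design =
  profile :: "nat \<Rightarrow> real \<Rightarrow> real vec"
  gain_a :: "nat \<Rightarrow> real mat"
  gain_b :: "nat \<Rightarrow> real mat"

definition well_formed_design :: "plant \<Rightarrow> design \<Rightarrow> bool" where
  "well_formed_design P C \<longleftrightarrow> (\<forall>l\<le>nsub P + 1.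
     gain_a C l \<in> carrier_mat (bsize P l) (bsize P l)
     \<and> gain_b C l \<in> carrier_mat (bsize P l) (bsize P l))"

definition err :: "plant \<Rightarrow> design \<Rightarrow> (real \<Rightarrow> real vec) \<Rightarrow> nat \<Rightarrow> real \<Rightarrow> real vec" where
  "err P C q l t = qa P l (q t) - profile C l t"

definition v_ext ::
    "plant \<Rightarrow> design \<Rightarrow> real set \<Rightarrow> (real \<Rightarrow> real vec) \<Rightarrow> nat \<Rightarrow> real \<Rightarrow> real vec" where
  "v_ext P C T q l t = ddt T (ddt T (profile C l)) t
     - gain_a C l *\<^sub>v err P C q l t - gain_b C l *\<^sub>v ddt T (err P C q l) t"

definition u_of_v ::
    "plant \<Rightarrow> real set \<Rightarrow> (real \<Rightarrow> real vec) \<Rightarrow> nat \<Rightarrow> real \<Rightarrow> real vec \<Rightarrow> real vec" where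
  "u_of_v P T q l t v = minv (Ba P l (q t)) *\<^sub>v
     (Daa P l (q t) *\<^sub>v v + Dau P l (q t) *\<^sub>v qu P l (ddt T (ddt T q) t)
       + Ha P l (q t) (ddt T q t))"

definition u_ext ::
    "plant \<Rightarrow> design \<Rightarrow> real set \<Rightarrow> (real \<Rightarrow> real vec) \<Rightarrow> nat \<Rightarrow> real \<Rightarrow> real vec" where
  "u_ext P C T q l t = u_of_v P T q l t (v_ext P C T q l t)"

text \<open>
  In the balance equation the position, velocity and acceleration of $q_a^{(l+1)}$ are replaced
  by the equilibrium and by zeros; everything else, including the value of the input
  $u_l^{\mathrm{ext}}$, is that of the trajectory at time \<open>t\<close>.
\<close>

definition balance_profiles ::
    "plant \<Rightarrow> design \<Rightarrow> real set \<Rightarrow> (real \<Rightarrow> real vec) \<Rightarrow> bool" where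
  "balance_profiles P C T q \<longleftrightarrow> (\<forall>t\<in>T. \<forall>l\<le>nsub P.
     (let x = put_qa P (l + 1) (q t) (profile C (l + 1) t);
          zr = 0\<^sub>v (bsize P (l + 1));
          y = put_qa P (l + 1) (ddt T q t) zr;
          w = put_qa P (l + 1) (ddt T (ddt T q) t) zr
      in x \<in> cspace P \<and> sub_residual P (l + 1) x y w (u_ext P C T q l t) = zr))"

text \<open>At level $k+1$ the formula for $v_{k+1}^{\mathrm{int}}$ is that of \<open>v_ext\<close>.\<close>

function (sequential)
  v_int :: "plant \<Rightarrow> design \<Rightarrow> real set \<Rightarrow> (real \<Rightarrow> real vec) \<Rightarrow> nat \<Rightarrow> real \<Rightarrow> real vec" and
  u_int :: "plant \<Rightarrow> design \<Rightarrow> real set \<Rightarrow> (real \<Rightarrow> real vec) \<Rightarrow> nat \<Rightarrow> real \<Rightarrow> real vec"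
where
  "v_int P C T q l t =
     (if l \<le> nsub P then
        minv (Daa P l (q t)) *\<^sub>v
          (Ba P l (q t) *\<^sub>v u_int P C T q (l + 1) t
           - Dau_part P l (l + 1) (q t) *\<^sub>v v_int P C T q (l + 1) t
           - finsum_vec TYPE(real) (nact P)
               (\<lambda>j. Dau_part P l (j + 1) (q t) *\<^sub>v qa P (j + 1) (ddt T (ddt T q) t))
               {l + 1..nsub P}
           - Ha P l (q t) (ddt T q t))
      else v_ext P C T q l t)"
| "u_int P C T q l t =
     (if l \<le> nsub P then u_of_v P T q l t (v_int P C T q l t)
      else mp_inverse (Bl P l (q t)) *\<^sub>v
        (Dl P l (q t) *\<^sub>v v_int P C T q l t + Hl P l (q t) (ddt T q t)))"
  by pat_completeness auto
termination
  by (relation "measure (\<lambda>s. case s of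
       Inl (P, C, T, q, l, t) \<Rightarrow> 2 * (nsub P + 1 - l)
     | Inr (P, C, T, q, l, t) \<Rightarrow> 2 * (nsub P + 1 - l) + 1)") auto

declare v_int.simps [simp del] u_int.simps [simp del]

end

theory Submission
  imports Defs
begin

text \<open>
  Block elimination splits $\mathcal S^l$ into $\mathcal S_a^l$ and $\mathcal S^{l+1}$ for every
  input $u$, and $u_l^{\mathrm{int}}$ is an inverse-dynamics law, so under it $\mathcal S_a^l$ says
  $\ddot q_a^{(l)} = v_l^{\mathrm{int}}$. The definition of $v_l^{\mathrm{int}}$ gives
  \[ u_l^{\mathrm{int}} - u_{l+1}^{\mathrm{int}} =
     (B_a^{(l)})^{-1} D_{au,l+1}^{(l)} (\ddot q_a^{(l+1)} - v_{l+1}^{\mathrm{int}}). \]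
  Substituting this into $\mathcal S_a^{l+1}$ under $u_l^{\mathrm{int}}$ leaves the coupling matrix
  applied to $\ddot q_a^{(l+1)} - v_{l+1}^{\mathrm{int}}$, which therefore vanishes; then
  $u_l^{\mathrm{int}} = u_{l+1}^{\mathrm{int}}$ and one descends to the next level.
\<close>

section \<open>Linear algebra\<close>

lemma dim_row_mult_mat_vec: "A \<in> carrier_mat r c \<Longrightarrow> A *\<^sub>v v \<in> carrier_vec r"
  by (intro carrier_vecI) simp

lemma mult_mat_vec_zero: "A \<in> carrier_mat r c \<Longrightarrow> A *\<^sub>v 0\<^sub>v c = 0\<^sub>v r"
  by (intro eq_vecI) (auto simp: scalar_prod_def)

lemma vec_add_cancel:
  fixes a b c :: "real vec"
  assumes "a \<in> carrier_vec n" "b \<in> carrier_vec n" "c \<in> carrier_vec n"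
  shows "a + c = b + c \<longleftrightarrow> a = b"
  using assms by (auto simp: vec_eq_iff)

text \<open>Vector sums and differences take their dimension from the second operand, so the first
  may be any term, whatever is known about its carrier.\<close>

lemma arith_carrier_right:
  assumes "b \<in> carrier_vec n"
  shows "a + b \<in> carrier_vec n" "a - b \<in> carrier_vec n"
  using assms by (auto intro!: carrier_vecI)

lemma minus_vec_eq_zero_iff:
  fixes a b :: "real vec"
  assumes "a \<in> carrier_vec n" "b \<in> carrier_vec n"
  shows "a - b = 0\<^sub>v n \<longleftrightarrow> a = b"
  using assms by (auto simp: vec_eq_iff)

section \<open>Inverses of nonsingular matrices, Moore-Penrose inverses at full row rank\<close>

text \<open>\<open>minv\<close> takes \<open>the\<close> of an option; a nonzero determinant makes
  the matrix a unit, which rules out \<open>None\<close>.\<close>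

lemma minv_inverts:
  assumes A: "A \<in> carrier_mat n n" and det: "det A \<noteq> 0"
  shows "minv A \<in> carrier_mat n n" "A * minv A = 1\<^sub>m n" "minv A * A = 1\<^sub>m n"
proof -
  \<comment> \<open>The argument \<open>()\<close> fills the record extension of the matrix ring in
    whose units both facts are phrased.\<close>
  obtain X where X: "mat_inverse A = Some X"
    using mat_inverse(1)[OF A, of "()"] det_non_zero_imp_unit[OF A det, of "()"] by (cases "mat_inverse A") auto
  show "minv A \<in> carrier_mat n n" "A * minv A = 1\<^sub>m n" "minv A * A = 1\<^sub>m n"
    using mat_inverse(2)[OF A X] by (simp_all add: minv_def X)
qed

lemma det_nonzero_if_mrank:
  assumes "A \<in> carrier_mat n n" "mrank A = n"
  shows "det A \<noteq> 0"
  using vec_space.det_rank_iff[OF assms(1)] assms by (simp add: mrank_def)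

lemma mult_mat_vec_eq_cancel:
  fixes A :: "real mat"
  assumes A: "A \<in> carrier_mat n n" and det: "det A \<noteq> 0"
    and v: "v \<in> carrier_vec n" "v' \<in> carrier_vec n"
  shows "A *\<^sub>v v = A *\<^sub>v v' \<longleftrightarrow> v = v'"
proof
  assume eq: "A *\<^sub>v v = A *\<^sub>v v'"
  have "u = minv A *\<^sub>v (A *\<^sub>v u)" if "u \<in> carrier_vec n" for u
    using minv_inverts[OF A det] A that by (simp flip: assoc_mult_mat_vec)
  then show "v = v'" using eq v by metis
qed simp

text \<open>Full row rank makes the column space everything, so a vector of the kernel of
  $A^T$ is orthogonal to itself.\<close>

lemma det_gram_nonzero:
  assumes A: "A \<in> carrier_mat r c" and rank: "mrank A = r"
  shows "det (A * transpose_mat A) \<noteq> 0"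
proof
  interpret vec_space "TYPE(real)" r .
  assume "det (A * transpose_mat A) = 0"
  then obtain v where v: "v \<in> carrier_vec r" "v \<noteq> 0\<^sub>v r"
    and AAv: "(A * transpose_mat A) *\<^sub>v v = 0\<^sub>v r"
    using det_0_iff_vec_prod_zero_field[of "A * transpose_mat A" r] A by auto
  define u where "u = transpose_mat A *\<^sub>v v"
  have u: "u \<in> carrier_vec c" using A v by (auto simp: u_def)
  have Au: "A *\<^sub>v u = 0\<^sub>v r" using AAv A v by (simp add: u_def)
  \<comment> \<open>Moving \<open>A\<close> across the scalar product shows that the kernel of the
    Gram matrix lies in the kernel of the transpose.\<close>
  have "scalar_prod u u = scalar_prod v (A *\<^sub>v u)"
    unfolding u_def using transpose_vec_mult_scalar[OF A u v(1)] by (simp add: u_def)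
  then have "scalar_prod u u = 0" using Au v by simp
  then have u0: "u = 0\<^sub>v c"
    using u by (intro eq_vecI) (auto simp: scalar_prod_def sum_nonneg_eq_0_iff)
  have cols: "set (cols A) \<subseteq> carrier_vec r" using A cols_dim by blast
  \<comment> \<open>The rank counts a maximal independent set of columns; \<open>r\<close>
    independent vectors in dimension \<open>r\<close> form a basis, so \<open>A\<close> is onto and
    \<open>v\<close> has a preimage \<open>s\<close>.\<close>
  obtain S where S: "maximal S (\<lambda>T. T \<subseteq> set (cols A) \<and> lin_indpt T)" "finite S"
    using maximal_exists_superset[of "set (cols A)" "\<lambda>T. T \<subseteq> set (cols A) \<and> lin_indpt T" "{}"]
    by (meson List.finite_set empty_subsetI finite_lin_indpt2 finite.emptyI empty_iff)
  have S': "S \<subseteq> set (cols A)" "lin_indpt S" using S(1) by (auto simp: maximal_def)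
  have "card S = r"
    using rank_card_indpt[OF A S(1)] rank A by (simp add: mrank_def)
  then have "basis S"
    using S' S(2) cols by (intro dim_li_is_basis) (auto simp: dim_is_n)
  then have "span S = carrier_vec r" by (auto simp: basis_def)
  then have "v \<in> col_space A"
    using v(1) span_is_monotone[OF S'(1)] by (auto simp: col_space_def)
  then obtain s where s: "s \<in> carrier_vec c" "A *\<^sub>v s = v"
    using col_space_eq[OF A] A by auto
  have "scalar_prod v v = scalar_prod u s"
    unfolding u_def using transpose_vec_mult_scalar[OF A s(1) v(1)] s by simp
  then have "scalar_prod v v = 0" using u0 s by simp
  then have "v = 0\<^sub>v r"
    using v by (intro eq_vecI) (auto simp: scalar_prod_def sum_nonneg_eq_0_iff)
  then show False using v by simp
qed

text \<open>AX and AY are symmetric, with AX AY = AY and AY AX = AX; transposing one product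
  identifies them, and likewise XA = YA. Then X = XAX = YAX = YAY = Y.\<close>

lemma is_mp_inverse_unique:
  assumes A: "A \<in> carrier_mat r c" and X: "is_mp_inverse A X" and Y: "is_mp_inverse A Y"
  shows "X = Y"
proof -
  have cX: "X \<in> carrier_mat c r" and cY: "Y \<in> carrier_mat c r"
    using A X Y by (auto simp: is_mp_inverse_def)
  have X': "A * X * A = A" "X * A * X = X" "transpose_mat (A * X) = A * X"
      "transpose_mat (X * A) = X * A"
    and Y': "A * Y * A = A" "Y * A * Y = Y" "transpose_mat (A * Y) = A * Y"
      "transpose_mat (Y * A) = Y * A"
    using X Y by (auto simp: is_mp_inverse_def)
  have swap: "P' * P = transpose_mat (P * P')"
    if "P \<in> carrier_mat d d" "P' \<in> carrier_mat d d" "transpose_mat P = P" "transpose_mat P' = P'"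
    for P P' :: "real mat" and d
    using transpose_mult[OF that(1,2)] that(3,4) by simp
  note c = mult_carrier_mat[OF A cX] mult_carrier_mat[OF A cY]
    mult_carrier_mat[OF cX A] mult_carrier_mat[OF cY A]
  have "A * X * (A * Y) = A * Y" "A * Y * (A * X) = A * X"
    using X'(1) Y'(1) assoc_mult_mat[OF c(1) A cY] assoc_mult_mat[OF c(2) A cX] by simp_all
  then have AXY: "A * X = A * Y"
    using swap[OF c(1,2) X'(3) Y'(3)] X'(3) Y'(3) by simp
  have "X * A * (Y * A) = X * A" "Y * A * (X * A) = Y * A"
    using X'(1) Y'(1) assoc_mult_mat[OF cX A c(4)] assoc_mult_mat[OF A cY A]
      assoc_mult_mat[OF cY A c(3)] assoc_mult_mat[OF A cX A] by simp_all
  then have XAY: "X * A = Y * A"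
    using swap[OF c(3,4) X'(4) Y'(4)] X'(4) Y'(4) by simp
  have "X = Y * A * X" using X'(2) XAY by simp
  also have "\<dots> = Y * (A * X)" using A cX cY by simp
  also have "\<dots> = Y * A * Y" using AXY A cX cY by simp
  finally show ?thesis using Y'(2) by simp
qed

text \<open>At full row rank the Moore-Penrose inverse is A^T (A A^T)^-1, the Gram matrix being
  nonsingular. This serves level k+1, where B^(k+1) is z by n of rank z.\<close>

lemma mp_inverse_right_inverse:
  assumes A: "A \<in> carrier_mat r c" and rank: "mrank A = r"
  shows "mp_inverse A \<in> carrier_mat c r" "A * mp_inverse A = 1\<^sub>m r"
proof -
  let ?G = "A * transpose_mat A"
  define X where "X = transpose_mat A * minv ?G"
  have G: "?G \<in> carrier_mat r r" using A by simp
  note iG = minv_inverts[OF G det_gram_nonzero[OF A rank]]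
  have X: "X \<in> carrier_mat c r" using A iG by (simp add: X_def)
  have AX: "A * X = 1\<^sub>m r"
    using A iG by (simp add: X_def flip: assoc_mult_mat)
  have "transpose_mat ?G = ?G"
    using transpose_mult[OF A transpose_carrier_mat[THEN iffD2, OF A]] by simp
  \<comment> \<open>The transposed right inverse of a symmetric matrix is a left inverse; left and
    right inverses coincide, so the inverse Gram matrix is symmetric.\<close>
  then have left: "transpose_mat (minv ?G) * ?G = 1\<^sub>m r"
    using transpose_mult[OF G iG(1)] iG(2) by simp
  have "transpose_mat (minv ?G) = transpose_mat (minv ?G) * ?G * minv ?G"
    using assoc_mult_mat[OF _ G iG(1), of "transpose_mat (minv ?G)" r] iG by simp
  then have sym: "transpose_mat (minv ?G) = minv ?G"
    using left iG(1) by simp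
  have "transpose_mat X = minv ?G * A"
    using A iG by (simp add: X_def sym transpose_mult[of _ c r])
  then have "transpose_mat (X * A) = transpose_mat A * (minv ?G * A)"
    using transpose_mult[OF X A] by simp
  also have "\<dots> = X * A"
    using A iG by (simp add: X_def assoc_mult_mat[of _ c r])
  finally have "is_mp_inverse A X"
    using A X AX by (auto simp: is_mp_inverse_def assoc_mult_mat[OF X A X])
  then have "mp_inverse A = X"
    unfolding mp_inverse_def using is_mp_inverse_unique[OF A] by blast
  then show "mp_inverse A \<in> carrier_mat c r" "A * mp_inverse A = 1\<^sub>m r" using X AX by auto
qed

section \<open>Block elimination and block products\<close>

text \<open>C A^-1 times the first row, \<open>row\<close>, is subtracted from the second. As
  \<open>row\<close> holds, this is reversible, whence an equivalence.\<close>

lemma schur_elimination: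
  assumes A: "A \<in> carrier_mat n n" and det: "det A \<noteq> 0"
    and B: "B \<in> carrier_mat n p" and C: "C \<in> carrier_mat p n" and E: "E \<in> carrier_mat p p"
    and Ma: "Ma \<in> carrier_mat n r" and Mu: "Mu \<in> carrier_mat p r"
    and xa: "xa \<in> carrier_vec n" and xu: "xu \<in> carrier_vec p"
    and ha: "ha \<in> carrier_vec n" and hu: "hu \<in> carrier_vec p" and u: "u \<in> carrier_vec r"
    and row: "A *\<^sub>v xa + B *\<^sub>v xu + ha = Ma *\<^sub>v u"
  shows "C *\<^sub>v xa + E *\<^sub>v xu + hu = Mu *\<^sub>v u \<longleftrightarrow>
    (E - C * minv A * B) *\<^sub>v xu + (hu - C * minv A *\<^sub>v ha) = (Mu - C * minv A * Ma) *\<^sub>v u"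
proof -
  note iA = minv_inverts[OF A det]
  define G where "G = C * minv A"
  have G: "G \<in> carrier_mat p n" using C iA by (simp add: G_def)
  have "G * A = C" using C iA A by (simp add: G_def)
  then have Cxa: "C *\<^sub>v xa = G *\<^sub>v (A *\<^sub>v xa)" using G A xa by (metis assoc_mult_mat_vec)
  have eq1: "G *\<^sub>v (Ma *\<^sub>v u) = C *\<^sub>v xa + G *\<^sub>v (B *\<^sub>v xu) + G *\<^sub>v ha"
    unfolding row[symmetric] Cxa using G A B xa xu ha
    by (simp add: mult_add_distrib_mat_vec[of _ p n])
  have eq2: "(E - G * B) *\<^sub>v xu = E *\<^sub>v xu - G *\<^sub>v (B *\<^sub>v xu)"
    "(Mu - G * Ma) *\<^sub>v u = Mu *\<^sub>v u - G *\<^sub>v (Ma *\<^sub>v u)"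
    using G B E xu Ma Mu u
    by (simp_all add: minus_mult_distrib_mat_vec[of _ p p] minus_mult_distrib_mat_vec[of _ p r])
  \<comment> \<open>Meant for a = C xa, b = E xu, e = Mu u, f = G B xu, g = G ha, h = hu:
    \<open>f\<close> and \<open>g\<close> cancel between the two sides, which leaves the second
    row.\<close>
  have balance: "a + b + h = e \<longleftrightarrow> b - f + (h - g) = e - (a + f + g)"
    if "a \<in> carrier_vec p" "b \<in> carrier_vec p" "e \<in> carrier_vec p" "f \<in> carrier_vec p"
      "g \<in> carrier_vec p" "h \<in> carrier_vec p" for a b e f g h :: "real vec"
    using that by (auto simp: vec_eq_iff algebra_simps)
  show ?thesis unfolding G_def[symmetric] eq2 eq1
    by (rule balance) (use C E G Mu hu B xa xu ha u in simp_all)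
qed

lemma blk_carrier:
  assumes "A \<in> carrier_mat (r + r') (c + c')"
  shows "blk11 A r c \<in> carrier_mat r c" "blk12 A r c \<in> carrier_mat r c'"
    "blk21 A r c \<in> carrier_mat r' c" "blk22 A r c \<in> carrier_mat r' c'"
  using assms by (auto simp: blk11_def blk12_def blk21_def blk22_def split_block_def Let_def)

lemma mult_mat_vec_blocks:
  assumes A: "A \<in> carrier_mat (r + r') (c + c')" and v: "v \<in> carrier_vec (c + c')"
  shows "A *\<^sub>v v =
    (blk11 A r c *\<^sub>v vec_first v c + blk12 A r c *\<^sub>v vec_last v c') @\<^sub>v
    (blk21 A r c *\<^sub>v vec_first v c + blk22 A r c *\<^sub>v vec_last v c')"
proof -
  have "A = four_block_mat (blk11 A r c) (blk12 A r c) (blk21 A r c) (blk22 A r c)"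
    using A by (auto simp: blk11_def blk12_def blk21_def blk22_def split_block_def Let_def)
  moreover have "v = vec_first v c @\<^sub>v vec_last v c'" using v by simp
  ultimately show ?thesis
    using four_block_mat_mult_vec[OF blk_carrier[OF A] vec_first_carrier[of v c]
        vec_last_carrier[of v c']] by metis
qed

lemma mult_mat_vec_block_rows:
  assumes A: "A \<in> carrier_mat (r + r') c" and v: "v \<in> carrier_vec c"
  shows "A *\<^sub>v v = (blk11 A r c *\<^sub>v v) @\<^sub>v (blk21 A r c *\<^sub>v v)"
proof (rule eq_vecI)
  fix i assume "i < dim_vec ((blk11 A r c *\<^sub>v v) @\<^sub>v (blk21 A r c *\<^sub>v v))"
  then have i: "i < r + r'"
    using A by (simp add: blk11_def blk21_def split_block_def Let_def)
  show "(A *\<^sub>v v) $ i = ((blk11 A r c *\<^sub>v v) @\<^sub>v (blk21 A r c *\<^sub>v v)) $ i"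
    using i A v
    by (auto simp: blk11_def blk21_def split_block_def Let_def scalar_prod_def intro!: sum.cong)
qed (use A in \<open>simp add: blk11_def blk21_def split_block_def Let_def\<close>)

lemma blk11_full: "A \<in> carrier_mat r c \<Longrightarrow> blk11 A r c = A"
  by (auto simp: blk11_def split_block_def Let_def)

text \<open>The layout of the unactuated coordinates of a level: \<open>a\<close> blocks of length
  \<open>n\<close>, then a last one of length \<open>z\<close>, which is the term i = a.\<close>

lemma sum_lessThan_blocks:
  fixes f :: "nat \<Rightarrow> 'a :: comm_monoid_add"
  shows "sum f {..<a * n + z} = (\<Sum>i\<le>a. \<Sum>c<(if i < a then n else z). f (i * n + c))"
proof -
  have shift: "(\<Sum>c<z. f (s + c)) = sum f {s..<s + z}" for s z
    using sum.shift_bounds_nat_ivl[of f 0 s z] by (simp add: lessThan_atLeast0 add.commute)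
  have "sum f {..<a * n + z} = sum f {..<a * n} + sum f {a * n..<a * n + z}"
    by (subst sum.union_disjoint[symmetric]) (auto intro!: sum.cong)
  also have "sum f {..<a * n} = (\<Sum>i<a. \<Sum>c<n. f (i * n + c))"
    unfolding shift by (simp add: sum.nat_group[symmetric] mult.commute)
  finally show ?thesis
    by (simp add: shift lessThan_Suc_atMost[symmetric])
qed

section \<open>The cascade at a fixed configuration\<close>

locale regular_configuration =
  fixes P :: plant and x :: "real vec"
  assumes plant: "well_formed_plant P"
    and standing: "standing_conditions P"
    and config: "x \<in> cspace P"
begin

section \<open>Dimensions at each level of the cascade\<close>

text \<open>The number of coordinates of q^(l). The truncated subtraction is exact for l <= k+1, by
  \<open>lev_bounds\<close>.\<close>

definition lev :: "nat \<Rightarrow> nat" where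
  "lev l = ndof P - l * nact P"

lemma lev_bounds: "l \<le> nsub P + 1 \<Longrightarrow> l * nact P + lev l = ndof P"
proof -
  assume "l \<le> nsub P + 1"
  then have "l * nact P \<le> (nsub P + 1) * nact P" by (rule mult_le_mono1)
  then show ?thesis by (simp add: lev_def ndof_def)
qed

lemma lev_Suc: "l \<le> nsub P \<Longrightarrow> lev l = nact P + lev (Suc l)"
  using lev_bounds[of l] lev_bounds[of "Suc l"] by simp

lemma lev_last: "lev (Suc (nsub P)) = nlast P"
  using lev_bounds[of "nsub P + 1"] by (simp add: ndof_def)

lemma lev_eq: "l \<le> nsub P \<Longrightarrow> lev (Suc l) = (nsub P - l) * nact P + nlast P"
  using lev_bounds[of "Suc l"] by (simp add: ndof_def diff_mult_distrib)

lemma bsize_simps [simp]: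
  "l \<le> nsub P \<Longrightarrow> bsize P l = nact P" "bsize P (Suc (nsub P)) = nlast P"
  by (simp_all add: bsize_def)

lemma level_cases:
  assumes "l \<le> nsub P + 1"
  obtains "l \<le> nsub P" | "l = Suc (nsub P)"
  using assms by linarith

text \<open>The subtraction does not truncate. At level k+1 the remainder is 0, so the complementary
  blocks there are empty.\<close>

lemma dim_residual_block:
  "l \<le> nsub P + 1 \<Longrightarrow> lev l = bsize P l + (lev l - bsize P l)"
  by (erule level_cases) (auto simp: lev_Suc lev_last)

lemma Dl_carrier: "l \<le> nsub P + 1 \<Longrightarrow> Dl P l x \<in> carrier_mat (lev l) (lev l)"
proof (induction l)
  case 0
  then show ?case using plant config by (auto simp: well_formed_plant_def lev_def)
next
  case (Suc l)
  then have "Dl P l x \<in> carrier_mat (nact P + lev (Suc l)) (nact P + lev (Suc l))"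
    by (simp add: lev_Suc)
  from blk_carrier[OF this] Suc.prems show ?case
    by (auto simp: Let_def)
qed

lemma
  assumes "l \<le> nsub P + 1"
  shows Daa_carrier: "Daa P l x \<in> carrier_mat (bsize P l) (bsize P l)"
    and Dau_carrier: "Dau P l x \<in> carrier_mat (bsize P l) (lev l - bsize P l)"
    and Dua_carrier: "Dua P l x \<in> carrier_mat (lev l - bsize P l) (bsize P l)"
  using blk_carrier[of "Dl P l x" "bsize P l" "lev l - bsize P l" "bsize P l" "lev l - bsize P l"]
    Dl_carrier[OF assms] dim_residual_block[OF assms]
  by (auto simp: Daa_def Dau_def Dua_def)

lemma det_Daa: "l \<le> nsub P + 1 \<Longrightarrow> det (Daa P l x) \<noteq> 0"
  using det_nonzero_if_mrank[OF Daa_carrier] standing config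
  by (elim level_cases) (auto simp: standing_conditions_def)

lemma minv_Daa_carrier: "l \<le> nsub P + 1 \<Longrightarrow> minv (Daa P l x) \<in> carrier_mat (bsize P l) (bsize P l)"
  using minv_inverts(1)[OF Daa_carrier det_Daa] .

lemma Hl_carrier:
  assumes y: "y \<in> carrier_vec (ndof P)"
  shows "l \<le> nsub P + 1 \<Longrightarrow> Hl P l x y \<in> carrier_vec (lev l)"
proof (induction l)
  case 0
  then show ?case using plant config y by (auto simp: well_formed_plant_def lev_def)
next
  case (Suc l)
  then show ?case
    using Dua_carrier[of l] minv_Daa_carrier[of l] by (auto simp: Let_def lev_Suc)
qed

lemma Bl_carrier: "l \<le> nsub P + 1 \<Longrightarrow> Bl P l x \<in> carrier_mat (lev l) (nact P)"
proof (induction l)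
  case 0
  have "ndof P = nact P + (ndof P - nact P)" by (simp add: ndof_def)
  then show ?case
    using carrier_append_rows[OF one_carrier_mat zero_carrier_mat, of "nact P" "ndof P - nact P"]
    by (simp add: lev_def)
next
  case (Suc l)
  \<comment> \<open>A column split with an empty right part brings the input matrix into the shape
    required by \<open>blk_carrier\<close>.\<close>
  then have "Bl P l x \<in> carrier_mat (nact P + lev (Suc l)) (nact P + 0)"
    by (simp add: lev_Suc)
  from blk_carrier[OF this] Suc.prems show ?case
    using Dua_carrier[of l] minv_Daa_carrier[of l] by (auto simp: Let_def lev_Suc)
qed

lemma Ba_carrier:
  assumes "l \<le> nsub P + 1"
  shows "Ba P l x \<in> carrier_mat (bsize P l) (nact P)"
  using blk_carrier(1)[of "Bl P l x" "bsize P l" "lev l - bsize P l" "nact P" 0]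
    Bl_carrier[OF assms] dim_residual_block[OF assms] by (simp add: Ba_def)

lemma Dau_part_carrier: "Dau_part P l j x \<in> carrier_mat (bsize P l) (bsize P j)"
  by (simp add: Dau_part_def)

lemma Ha_carrier: "Ha P l x y \<in> carrier_vec (bsize P l)"
  by (simp add: Ha_def)

lemma ql_carrier: "ql P l w \<in> carrier_vec (lev l)"
  by (simp add: ql_def lev_def)

lemma qa_carrier: "qa P l w \<in> carrier_vec (bsize P l)"
  by (simp add: qa_def)

lemma qu_carrier: "qu P l w \<in> carrier_vec (lev l - bsize P l)"
  by (simp add: qu_def lev_def)

text \<open>At level k+1 the first block is as large as the whole system and \<open>Dau\<close> has
  no columns, so the convention S_a^(k+1) = S^(k+1) becomes a fact.\<close>

lemma last_level:
  assumes y: "y \<in> carrier_vec (ndof P)"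
  shows "Daa P (Suc (nsub P)) x = Dl P (Suc (nsub P)) x"
    "Ba P (Suc (nsub P)) x = Bl P (Suc (nsub P)) x"
    "Ha P (Suc (nsub P)) x y = Hl P (Suc (nsub P)) x y"
    "qa P (Suc (nsub P)) w = ql P (Suc (nsub P)) w"
    "Dau P (Suc (nsub P)) x *\<^sub>v qu P (Suc (nsub P)) w = 0\<^sub>v (nlast P)"
proof -
  let ?k = "Suc (nsub P)"
  show "Daa P ?k x = Dl P ?k x" "Ba P ?k x = Bl P ?k x"
    using Dl_carrier[of ?k] Bl_carrier[of ?k] by (auto simp: Daa_def Ba_def blk11_full lev_last)
  show "Ha P ?k x y = Hl P ?k x y"
    using Hl_carrier[OF y, of ?k] by (auto simp: Ha_def vec_first_def lev_last)
  show "qa P ?k w = ql P ?k w"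
    using lev_last by (auto simp: qa_def ql_def vec_first_def lev_def)
  show "Dau P ?k x *\<^sub>v qu P ?k w = 0\<^sub>v (nlast P)"
    using Dau_carrier[of ?k] qu_carrier[of ?k w] lev_last
    by (intro eq_vecI) (auto simp: scalar_prod_def)
qed

section \<open>Splitting the systems by block rows\<close>

lemma sub_residual_eq_0_iff:
  assumes "l \<le> nsub P + 1" "u \<in> carrier_vec (nact P)"
  shows "sub_residual P l x y w u = 0\<^sub>v (bsize P l) \<longleftrightarrow>
    Daa P l x *\<^sub>v qa P l w + Dau P l x *\<^sub>v qu P l w + Ha P l x y = Ba P l x *\<^sub>v u"
  unfolding sub_residual_def
  by (rule minus_vec_eq_zero_iff)
    (use assms Daa_carrier[of l] Dau_carrier[of l] Ba_carrier[of l] Ha_carrier[of l y]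
      qa_carrier[of l w] qu_carrier[of l w] in auto)

lemma ql_Suc:
  assumes l: "l \<le> nsub P" and w: "w \<in> carrier_vec (ndof P)"
  shows "ql P (Suc l) w = qu P l w"
  using assms lev_Suc[OF l] by (auto simp: ql_def qu_def vec_last_def lev_def ac_simps intro!: eq_vecI)

text \<open>The first block row is kept; in its presence \<open>schur_elimination\<close> trades the
  second for S^(l+1). The input is arbitrary because the descent meets S^(l+1) driven by the control
  of level \<open>l\<close>.\<close>

lemma sys_split:
  assumes l: "l \<le> nsub P" and y: "y \<in> carrier_vec (ndof P)" and w: "w \<in> carrier_vec (ndof P)"
    and u: "u \<in> carrier_vec (nact P)"
  shows "sys P l x y w u \<longleftrightarrow>
    sub_residual P l x y w u = 0\<^sub>v (bsize P l) \<and> sys P (Suc l) x y w u"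
proof -
  let ?n = "nact P" and ?p = "lev (Suc l)" and ?D = "Dl P l x" and ?H = "Hl P l x y"
  have D: "?D \<in> carrier_mat (?n + ?p) (?n + ?p)" using Dl_carrier[of l] l by (simp add: lev_Suc)
  have B: "Bl P l x \<in> carrier_mat (?n + ?p) ?n" using Bl_carrier[of l] l by (simp add: lev_Suc)
  have B0: "Bl P l x \<in> carrier_mat (?n + ?p) (?n + 0)" using B by simp
  have H: "?H \<in> carrier_vec (?n + ?p)" using Hl_carrier[OF y, of l] l by (simp add: lev_Suc)
  have q: "ql P l w \<in> carrier_vec (?n + ?p)" using lev_Suc[OF l] by (simp add: ql_def lev_def)
  have qu: "qu P l w = vec_last (ql P l w) ?p" using l lev_Suc[OF l] by (simp add: qu_def lev_def)
  have Daa: "Daa P l x \<in> carrier_mat ?n ?n" and Dau: "Dau P l x \<in> carrier_mat ?n ?p"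
    and Dua: "Dua P l x \<in> carrier_mat ?p ?n" and Duu: "blk22 ?D ?n ?n \<in> carrier_mat ?p ?p"
    using blk_carrier[OF D] l by (simp_all add: Daa_def Dau_def Dua_def)
  have Ba: "Ba P l x \<in> carrier_mat ?n ?n" and Bu: "blk21 (Bl P l x) ?n ?n \<in> carrier_mat ?p ?n"
    using blk_carrier[OF B0] l by (simp_all add: Ba_def)
  have qa: "qa P l w \<in> carrier_vec ?n" using l by (simp add: qa_def)
  have qu': "qu P l w \<in> carrier_vec ?p" by (simp add: qu)
  have Ha: "Ha P l x y \<in> carrier_vec ?n" using l by (simp add: Ha_def)
  have Hsplit: "?H = Ha P l x y @\<^sub>v vec_last ?H ?p"
    using H l by (simp add: Ha_def)
  have "?D *\<^sub>v ql P l w = (Daa P l x *\<^sub>v qa P l w + Dau P l x *\<^sub>v qu P l w) @\<^sub>v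
      (Dua P l x *\<^sub>v qa P l w + blk22 ?D ?n ?n *\<^sub>v qu P l w)"
    using mult_mat_vec_blocks[OF D q] l by (simp add: Daa_def Dau_def Dua_def qa_def qu)
  then have "?D *\<^sub>v ql P l w + ?H =
      (Daa P l x *\<^sub>v qa P l w + Dau P l x *\<^sub>v qu P l w + Ha P l x y) @\<^sub>v
      (Dua P l x *\<^sub>v qa P l w + blk22 ?D ?n ?n *\<^sub>v qu P l w + vec_last ?H ?p)"
    using Daa Dau Dua Duu qa qu' Ha
    by (subst Hsplit) (auto intro!: append_vec_add[symmetric])
  moreover have "Bl P l x *\<^sub>v u = (Ba P l x *\<^sub>v u) @\<^sub>v (blk21 (Bl P l x) ?n ?n *\<^sub>v u)"
    using mult_mat_vec_block_rows[OF B u] l by (simp add: Ba_def)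
  ultimately have "sys P l x y w u \<longleftrightarrow>
      Daa P l x *\<^sub>v qa P l w + Dau P l x *\<^sub>v qu P l w + Ha P l x y = Ba P l x *\<^sub>v u \<and>
      Dua P l x *\<^sub>v qa P l w + blk22 ?D ?n ?n *\<^sub>v qu P l w + vec_last ?H ?p
        = blk21 (Bl P l x) ?n ?n *\<^sub>v u"
    unfolding sys_def
    using Daa Dau Dua Duu Ba Bu qa qu' Ha u
    by (simp add: append_vec_eq[of _ ?n])
  moreover have "sys P (Suc l) x y w u \<longleftrightarrow>
      (blk22 ?D ?n ?n - Dua P l x * minv (Daa P l x) * Dau P l x) *\<^sub>v qu P l w
        + (vec_last ?H ?p - Dua P l x * minv (Daa P l x) *\<^sub>v Ha P l x y)
      = (blk21 (Bl P l x) ?n ?n - Dua P l x * minv (Daa P l x) * Ba P l x) *\<^sub>v u"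
    using l H by (simp add: sys_def Let_def ql_Suc[OF l w] Daa_def Dau_def Dua_def Ba_def Ha_def)
  ultimately show ?thesis
    using schur_elimination[OF Daa _ Dau Dua Duu Ba Bu qa qu' Ha vec_last_carrier u] det_Daa[of l] l
      sub_residual_eq_0_iff[of l u y w] u
    by auto
qed

lemma sys_last:
  assumes y: "y \<in> carrier_vec (ndof P)" and u: "u \<in> carrier_vec (nact P)"
  shows "sys P (Suc (nsub P)) x y w u \<longleftrightarrow>
    sub_residual P (Suc (nsub P)) x y w u = 0\<^sub>v (nlast P)"
  using sub_residual_eq_0_iff[of "Suc (nsub P)" u y w] u Dl_carrier[of "Suc (nsub P)"]
    ql_carrier[of "Suc (nsub P)" w]
  by (simp add: last_level[OF y] sys_def lev_last right_zero_vec[OF mult_mat_vec_carrier]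
      del: Dl.simps Hl.simps Bl.simps)

text \<open>Sorts the columns of \<open>Dau\<close> by subsystem. The term of q_a^(l+1) stands apart
  because \<open>v_int\<close> replaces that acceleration by the prescribed one and keeps the actual
  ones in the remaining sum.\<close>

lemma Dau_mult_qu:
  assumes l: "l \<le> nsub P" and w: "w \<in> carrier_vec (ndof P)"
  shows "Dau P l x *\<^sub>v qu P l w = Dau_part P l (l + 1) x *\<^sub>v qa P (l + 1) w
    + finsum_vec TYPE(real) (nact P)
        (\<lambda>j. Dau_part P l (j + 1) x *\<^sub>v qa P (j + 1) w) {l + 1..nsub P}" (is "_ = _ + ?S")
proof (rule eq_vecI)
  let ?n = "nact P" and ?a = "nsub P - l"
  have Dp: "Dau_part P l j x *\<^sub>v qa P j w \<in> carrier_vec ?n" for j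
    using mult_mat_vec_carrier[OF Dau_part_carrier qa_carrier, of l j w] l by simp
  have S: "?S \<in> carrier_vec ?n"
    by (intro finsum_vec_closed) (use Dp in blast)
  then show "dim_vec (Dau P l x *\<^sub>v qu P l w) = dim_vec (Dau_part P l (l + 1) x *\<^sub>v qa P (l + 1) w + ?S)"
    using Dau_carrier[of l] l by simp
  fix r assume "r < dim_vec (Dau_part P l (l + 1) x *\<^sub>v qa P (l + 1) w + ?S)"
  then have r: "r < ?n" using S by simp
  \<comment> \<open>\<open>f\<close> lists the summands of row \<open>r\<close> column by column;
    q_u^(l) begins at coordinate (l+1)n.\<close>
  define f where "f c = Dau P l x $$ (r, c) * w $ (Suc l * ?n + c)" for c
  define g where "g j = (Dau_part P l (j + 1) x *\<^sub>v qa P (j + 1) w) $ r" for j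
  have "(Dau P l x *\<^sub>v qu P l w) $ r = sum f {..<lev (Suc l)}"
  proof -
    have "qu P l w $ c = w $ (Suc l * ?n + c)" if "c < lev (Suc l)" for c
      using that w lev_bounds[of "Suc l"] l
      by (simp add: ql_Suc[OF l w, symmetric] ql_def vec_last_def lev_def)
    then show ?thesis
      using r l Dau_carrier[of l] qu_carrier[of l w]
      by (auto simp: scalar_prod_def f_def lessThan_atLeast0 lev_Suc intro!: sum.cong)
  qed
  \<comment> \<open>Column block \<open>i\<close> belongs to subsystem l+1+i; the block i = k-l is
    the last, of length z.\<close>
  also have "\<dots> = (\<Sum>i\<le>?a. g (l + i))"
  proof -
    have "(\<Sum>c<(if i < ?a then ?n else nlast P). f (i * ?n + c)) = g (l + i)" if "i \<le> ?a" for i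
    proof -
      have b: "bsize P (Suc (l + i)) = (if i < ?a then ?n else nlast P)"
        using that l by (auto simp: bsize_def)
      have le: "Suc (l + i) \<le> nsub P + 1" using that l by simp
      have "qa P (Suc (l + i)) w $ c = w $ (Suc (l + i) * ?n + c)" if "c < bsize P (Suc (l + i))" for c
      proof -
        have "c < lev (Suc (l + i))" using dim_residual_block[OF le] that by linarith
        moreover have "ndof P - lev (Suc (l + i)) = Suc (l + i) * ?n"
          using lev_bounds[OF le] by linarith
        ultimately show ?thesis
          using that w unfolding qa_def ql_def lev_def[symmetric]
          by (simp add: vec_first_def vec_last_def)
      qed
      then show ?thesis
        unfolding b[symmetric] g_def f_def
        using r l qa_carrier[of "Suc (l + i)" w]
        by (auto simp: Dau_part_def scalar_prod_def lessThan_atLeast0 algebra_simps intro!: sum.cong)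
    qed
    then show ?thesis
      unfolding lev_eq[OF l] sum_lessThan_blocks by (intro sum.cong) auto
  qed
  also have "\<dots> = sum g {l..nsub P}"
    by (rule sum.reindex_bij_witness[of _ "\<lambda>j. j - l" "\<lambda>i. l + i"]) (use l in auto)
  also have "\<dots> = g l + sum g {l + 1..nsub P}"
    using l by (simp add: sum.atLeast_Suc_atMost)
  also have "sum g {l + 1..nsub P} = ?S $ r"
    unfolding g_def by (rule index_finsum_vec[symmetric]) (use r Dp in auto)
  finally show "(Dau P l x *\<^sub>v qu P l w) $ r = (Dau_part P l (l + 1) x *\<^sub>v qa P (l + 1) w + ?S) $ r"
    using S r by (simp add: g_def)
qed

end

declare Dl.simps(2) [simp del] Hl.simps(2) [simp del] Bl.simps(2) [simp del]

section \<open>The closed loop\<close>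

lemma ddt_carrier:
  assumes "f t \<in> carrier_vec d"
  shows "ddt T f t \<in> carrier_vec d"
  using assms by (auto simp: ddt_def)

text \<open>The closed-loop claim is pointwise in time, so \<open>t\<close> is fixed and the
  derivatives of \<open>q\<close> at \<open>t\<close> are treated as given vectors.\<close>

locale closed_loop = regular_configuration P "q t"
  for P :: plant and q :: "real \<Rightarrow> real vec" and t :: real +
  fixes C :: design and T :: "real set"
  assumes position: "q t \<in> carrier_vec (ndof P)"
    and profile: "profile C (Suc (nsub P)) t \<in> carrier_vec (nlast P)"
    and design: "well_formed_design P C"
begin

abbreviation vel :: "real vec" where
  "vel \<equiv> ddt T q t"

abbreviation acc :: "real vec" where
  "acc \<equiv> ddt T (ddt T q) t"

abbreviation v :: "nat \<Rightarrow> real vec" where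
  "v l \<equiv> v_int P C T q l t"

abbreviation u :: "nat \<Rightarrow> real vec" where
  "u l \<equiv> u_int P C T q l t"

text \<open>The terms that \<open>u_of_v\<close> compensates exactly; they cancel when dynamics and
  control are compared.\<close>

abbreviation drift :: "nat \<Rightarrow> real vec" where
  "drift l \<equiv> Dau P l (q t) *\<^sub>v qu P l acc + Ha P l (q t) vel"

lemma vel_carrier: "vel \<in> carrier_vec (ndof P)" and acc_carrier: "acc \<in> carrier_vec (ndof P)"
  using position by (simp_all add: ddt_carrier)

lemma det_Ba: "l \<le> nsub P \<Longrightarrow> det (Ba P l (q t)) \<noteq> 0"
  using det_nonzero_if_mrank[of "Ba P l (q t)" "nact P"] Ba_carrier[of l] standing config
  by (auto simp: standing_conditions_def)

lemma minv_Ba_carrier: "l \<le> nsub P \<Longrightarrow> minv (Ba P l (q t)) \<in> carrier_mat (nact P) (nact P)"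
  using minv_inverts(1)[OF _ det_Ba] Ba_carrier[of l] by simp

lemma mrank_Bl_last: "mrank (Bl P (Suc (nsub P)) (q t)) = nlast P"
  using standing config last_level(2)[OF vel_carrier]
  by (auto simp: standing_conditions_def)

lemmas Bl_last_carrier = Bl_carrier[of "Suc (nsub P)", unfolded lev_last, simplified]

text \<open>No induction along the mutual recursion: for l <= k the outermost factor
  \<open>minv\<close> fixes the dimension, and at level k+1 \<open>v_ext\<close> is
  explicit.\<close>

lemma v_carrier:
  assumes "l \<le> nsub P + 1"
  shows "v l \<in> carrier_vec (bsize P l)"
  using assms
proof (cases rule: level_cases)
  case 1
  then show ?thesis
    using dim_row_mult_mat_vec[OF minv_Daa_carrier[of l]] by (subst v_int.simps) simp
next
  case 2
  have "err P C q l t \<in> carrier_vec (nlast P)"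
    unfolding err_def using profile 2 by (auto intro: arith_carrier_right)
  moreover have "gain_a C l \<in> carrier_mat (nlast P) (nlast P)"
    "gain_b C l \<in> carrier_mat (nlast P) (nlast P)"
    using design 2 by (auto simp: well_formed_design_def)
  ultimately show ?thesis
    using 2 profile by (subst v_int.simps) (auto simp: v_ext_def ddt_carrier)
qed

lemma u_carrier:
  assumes "l \<le> nsub P + 1"
  shows "u l \<in> carrier_vec (nact P)"
  using assms
proof (cases rule: level_cases)
  case 1
  then show ?thesis
    using dim_row_mult_mat_vec[OF minv_Ba_carrier[of l]] by (subst u_int.simps) (simp add: u_of_v_def)
next
  case 2
  then show ?thesis
    using dim_row_mult_mat_vec[OF mp_inverse_right_inverse(1)[OF Bl_last_carrier mrank_Bl_last]]
    by (subst u_int.simps) simp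
qed

lemma drift_carrier: "l \<le> nsub P + 1 \<Longrightarrow> drift l \<in> carrier_vec (bsize P l)"
  by (intro add_carrier_vec dim_row_mult_mat_vec[OF Dau_carrier] Ha_carrier) simp

lemma residual_assoc:
  assumes l: "l \<le> nsub P + 1"
  shows "Daa P l (q t) *\<^sub>v p + Dau P l (q t) *\<^sub>v qu P l acc + Ha P l (q t) vel =
    Daa P l (q t) *\<^sub>v p + drift l"
  by (rule assoc_add_vec[OF dim_row_mult_mat_vec[OF Daa_carrier[OF l]]
        dim_row_mult_mat_vec[OF Dau_carrier[OF l]] Ha_carrier])

section \<open>Inverse dynamics and the comparison of consecutive controls\<close>

text \<open>For l <= k this rests on the invertibility of \<open>Ba\<close>, at level k+1 on the
  Moore-Penrose inverse being a right inverse at full row rank.\<close>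

lemma Ba_mult_u:
  assumes "l \<le> nsub P + 1"
  shows "Ba P l (q t) *\<^sub>v u l = Daa P l (q t) *\<^sub>v v l + drift l"
  using assms
proof (cases rule: level_cases)
  case 1
  let ?r = "Daa P l (q t) *\<^sub>v v l + Dau P l (q t) *\<^sub>v qu P l acc + Ha P l (q t) vel"
  have Ba: "Ba P l (q t) \<in> carrier_mat (nact P) (nact P)" using Ba_carrier[of l] 1 by simp
  have r: "?r \<in> carrier_vec (nact P)"
    using Ha_carrier[of l vel] 1 by (intro arith_carrier_right) simp
  have "Ba P l (q t) *\<^sub>v u l = Ba P l (q t) *\<^sub>v (minv (Ba P l (q t)) *\<^sub>v ?r)"
    using 1 by (subst u_int.simps) (simp add: u_of_v_def)
  also have "\<dots> = ?r"
    using assoc_mult_mat_vec[OF Ba minv_inverts(1)[OF Ba det_Ba[OF 1]] r] minv_inverts(2)[OF Ba det_Ba[OF 1]] r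
    by simp
  finally show ?thesis unfolding residual_assoc[OF assms] .
next
  case 2
  let ?r = "Dl P l (q t) *\<^sub>v v l + Hl P l (q t) vel"
  have r: "?r \<in> carrier_vec (nlast P)"
    using Hl_carrier[OF vel_carrier, of l] lev_last 2 by (intro arith_carrier_right) simp
  note B = Bl_last_carrier and X = mp_inverse_right_inverse[OF Bl_last_carrier mrank_Bl_last]
  have "Bl P l (q t) *\<^sub>v u l = Bl P l (q t) *\<^sub>v (mp_inverse (Bl P l (q t)) *\<^sub>v ?r)"
    using 2 by (subst u_int.simps) simp
  also have "\<dots> = ?r"
    using assoc_mult_mat_vec[OF B X(1) r] X(2) r 2 by simp
  \<comment> \<open>Here \<open>drift\<close> is just H^(k+1), since \<open>Dau\<close> has no
    columns.\<close>
  finally show ?thesis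
    using 2 last_level[OF vel_carrier] Hl_carrier[OF vel_carrier, of l] lev_last
    by simp
qed

lemma sub_residual_u_eq_0_iff:
  assumes l: "l \<le> nsub P + 1" and u': "u' \<in> carrier_vec (nact P)"
  shows "sub_residual P l (q t) vel acc u' = 0\<^sub>v (bsize P l) \<longleftrightarrow>
    Daa P l (q t) *\<^sub>v qa P l acc + drift l = Ba P l (q t) *\<^sub>v u'"
  unfolding sub_residual_eq_0_iff[OF assms]
  residual_assoc[OF l] ..

text \<open>By \<open>Ba_mult_u\<close> both sides of S_a^l contain \<open>drift\<close>; cancelling
  it leaves an equation between images under \<open>Daa\<close>, which is nonsingular.\<close>

lemma sub_residual_u_int:
  assumes l: "l \<le> nsub P + 1"
  shows "sub_residual P l (q t) vel acc (u l) = 0\<^sub>v (bsize P l) \<longleftrightarrow> qa P l acc = v l"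
proof -
  have D: "Daa P l (q t) *\<^sub>v p \<in> carrier_vec (bsize P l)" for p
    using dim_row_mult_mat_vec[OF Daa_carrier[OF l]] .
  show ?thesis
    unfolding sub_residual_u_eq_0_iff[OF l u_carrier[OF l]] Ba_mult_u[OF l]
      mult_mat_vec_eq_cancel[OF Daa_carrier[OF l] det_Daa[OF l] qa_carrier v_carrier[OF l], symmetric]
    using vec_add_cancel[OF D D drift_carrier[OF l]] .
qed

text \<open>Once \<open>drift\<close> is expanded by \<open>Dau_mult_qu\<close>, the sum and
  \<open>Ha\<close> cancel against their counterparts in \<open>v_int\<close>; only the block of
  q_a^(l+1) remains, as actual minus prescribed acceleration.\<close>

lemma u_int_diff:
  assumes l: "l \<le> nsub P"
  shows "u l = u (Suc l) + minv (Ba P l (q t)) *\<^sub>v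
    (Dau_part P l (Suc l) (q t) *\<^sub>v (qa P (Suc l) acc - v (Suc l)))"
proof -
  let ?n = "nact P" and ?Ba = "Ba P l (q t)" and ?Dp = "Dau_part P l (Suc l) (q t)"
    and ?qa = "qa P (Suc l) acc"
  let ?S = "finsum_vec TYPE(real) ?n (\<lambda>j. Dau_part P l (j + 1) (q t) *\<^sub>v qa P (j + 1) acc)
    {l + 1..nsub P}"
  have Ba: "?Ba \<in> carrier_mat ?n ?n" using Ba_carrier[of l] l by simp
  have Daa: "Daa P l (q t) \<in> carrier_mat ?n ?n" using Daa_carrier[of l] l by simp
  have Dp: "Dau_part P l j (q t) \<in> carrier_mat ?n (bsize P j)" for j
    using Dau_part_carrier[of l j] l by simp
  have S: "?S \<in> carrier_vec ?n"
    by (intro finsum_vec_closed) (use Dp qa_carrier mult_mat_vec_carrier in blast)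
  have u: "u l \<in> carrier_vec ?n" "u (Suc l) \<in> carrier_vec ?n"
    using u_carrier[of l] u_carrier[of "Suc l"] l by auto
  have v: "v (Suc l) \<in> carrier_vec (bsize P (Suc l))" using v_carrier[of "Suc l"] l by simp
  have Ha: "Ha P l (q t) vel \<in> carrier_vec ?n" using Ha_carrier[of l] l by simp
  have Bu: "?Ba *\<^sub>v u (Suc l) \<in> carrier_vec ?n" and Dv: "?Dp *\<^sub>v v (Suc l) \<in> carrier_vec ?n"
    and Dqa: "?Dp *\<^sub>v ?qa \<in> carrier_vec ?n"
    using Ba u Dp v qa_carrier[of "Suc l" acc] by (blast intro: mult_mat_vec_carrier)+
  let ?r = "?Ba *\<^sub>v u (Suc l) - ?Dp *\<^sub>v v (Suc l) - ?S - Ha P l (q t) vel"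
  have r: "?r \<in> carrier_vec ?n" using Ha by (rule arith_carrier_right)
  have det: "det (Daa P l (q t)) \<noteq> 0" using det_Daa[of l] l by simp
  have "Daa P l (q t) *\<^sub>v v l = Daa P l (q t) *\<^sub>v (minv (Daa P l (q t)) *\<^sub>v ?r)"
    using l by (subst v_int.simps) simp
  also have "\<dots> = ?r"
    using assoc_mult_mat_vec[OF Daa minv_inverts(1)[OF Daa det] r] minv_inverts(2)[OF Daa det] r by simp
  finally have "?Ba *\<^sub>v u l = ?r + (?Dp *\<^sub>v ?qa + ?S + Ha P l (q t) vel)"
    using Ba_mult_u[of l] Dau_mult_qu[OF l acc_carrier] l by simp
  also have "\<dots> = ?Ba *\<^sub>v u (Suc l) + (?Dp *\<^sub>v ?qa - ?Dp *\<^sub>v v (Suc l))"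
  proof -
    have "b - d - s - h + (d' + s + h) = b + (d' - d)"
      if "b \<in> carrier_vec ?n" "d \<in> carrier_vec ?n" "s \<in> carrier_vec ?n" "h \<in> carrier_vec ?n"
        "d' \<in> carrier_vec ?n" for b d s h d' :: "real vec"
      using that by (intro eq_vecI) auto
    from this[OF Bu Dv S Ha Dqa] show ?thesis .
  qed
  also have "?Dp *\<^sub>v ?qa - ?Dp *\<^sub>v v (Suc l) = ?Dp *\<^sub>v (?qa - v (Suc l))"
    by (rule mult_minus_distrib_mat_vec[OF Dp qa_carrier v, symmetric])
  finally have eq: "?Ba *\<^sub>v u l = ?Ba *\<^sub>v u (Suc l) + ?Dp *\<^sub>v (?qa - v (Suc l))" .
  have d: "?Dp *\<^sub>v (?qa - v (Suc l)) \<in> carrier_vec ?n"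
    by (rule dim_row_mult_mat_vec[OF Dp])
  note iBa = minv_inverts[OF Ba det_Ba[OF l]]
  have cancel: "minv ?Ba *\<^sub>v (?Ba *\<^sub>v p) = p" if "p \<in> carrier_vec ?n" for p
    using assoc_mult_mat_vec[OF iBa(1) Ba that] iBa(3) that by simp
  have "u l = minv ?Ba *\<^sub>v (?Ba *\<^sub>v u l)" using cancel[OF u(1)] by simp
  also have "\<dots> = u (Suc l) + minv ?Ba *\<^sub>v (?Dp *\<^sub>v (?qa - v (Suc l)))"
    unfolding eq mult_add_distrib_mat_vec[OF iBa(1) Bu d] cancel[OF u(2)] ..
  finally show ?thesis .
qed

text \<open>The level l+1 equation is driven by the control of level \<open>l\<close>. The mismatch
  \<open>u_int_diff\<close> is linear in the acceleration error, so the equation becomes homogeneous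
  in that error.\<close>

lemma sub_residual_u_int_Suc:
  assumes l: "l \<le> nsub P"
    and res: "sub_residual P (Suc l) (q t) vel acc (u l) = 0\<^sub>v (bsize P (Suc l))"
  shows "qa P (Suc l) acc = v (Suc l)"
proof -
  let ?n = "nact P" and ?s = "bsize P (Suc l)"
  let ?d = "qa P (Suc l) acc - v (Suc l)" and ?D = "Daa P (Suc l) (q t)"
    and ?B = "Ba P (Suc l) (q t)" and ?I = "minv (Ba P l (q t))"
    and ?Dp = "Dau_part P l (Suc l) (q t)"
  have l': "Suc l \<le> nsub P + 1" "l \<le> nsub P + 1" using l by auto
  have D: "?D \<in> carrier_mat ?s ?s" and B: "?B \<in> carrier_mat ?s ?n"
    and I: "?I \<in> carrier_mat ?n ?n" and Dp: "?Dp \<in> carrier_mat ?n ?s"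
    using Daa_carrier[OF l'(1)] Ba_carrier[OF l'(1)] minv_Ba_carrier[OF l] Dau_part_carrier[of l] l
    by auto
  note v = v_carrier[OF l'(1)] and u = u_carrier[OF l'(1)]
  have d: "?d \<in> carrier_vec ?s" using v by (intro minus_carrier_vec qa_carrier)
  have Id: "?I *\<^sub>v (?Dp *\<^sub>v ?d) \<in> carrier_vec ?n"
    by (rule dim_row_mult_mat_vec[OF I])
  have "?D *\<^sub>v qa P (Suc l) acc + drift (Suc l) = ?B *\<^sub>v u l"
    using res sub_residual_u_eq_0_iff[OF l'(1) u_carrier[OF l'(2)]] by blast
  also have "\<dots> = (?D *\<^sub>v v (Suc l) + drift (Suc l)) + ?B *\<^sub>v (?I *\<^sub>v (?Dp *\<^sub>v ?d))"
    unfolding u_int_diff[OF l] mult_add_distrib_mat_vec[OF B u Id] Ba_mult_u[OF l'(1)] ..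
  finally have "?D *\<^sub>v qa P (Suc l) acc + drift (Suc l) =
    (?D *\<^sub>v v (Suc l) + drift (Suc l)) + ?B *\<^sub>v (?I *\<^sub>v (?Dp *\<^sub>v ?d))" .
  moreover have "a - b = c" if "a + h = b + h + c" "a \<in> carrier_vec ?s" "b \<in> carrier_vec ?s"
     "c \<in> carrier_vec ?s" "h \<in> carrier_vec ?s" for a b c h :: "real vec"
    using that by (auto simp: vec_eq_iff)
  ultimately have "?D *\<^sub>v qa P (Suc l) acc - ?D *\<^sub>v v (Suc l) = ?B *\<^sub>v (?I *\<^sub>v (?Dp *\<^sub>v ?d))"
    using D B drift_carrier[OF l'(1)] v qa_carrier Id by (meson mult_mat_vec_carrier)
  then have "?D *\<^sub>v ?d = ?B *\<^sub>v (?I *\<^sub>v (?Dp *\<^sub>v ?d))"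
    using mult_minus_distrib_mat_vec[OF D qa_carrier v] by simp
  also have "\<dots> = (?B * ?I * ?Dp) *\<^sub>v ?d"
    using assoc_mult_mat_vec[OF mult_carrier_mat[OF B I] Dp d]
      assoc_mult_mat_vec[OF B I mult_mat_vec_carrier[OF Dp d]] by simp
  finally have eq: "?D *\<^sub>v ?d = (?B * ?I * ?Dp) *\<^sub>v ?d" .
  have BID: "?B * ?I * ?Dp \<in> carrier_mat ?s ?s" using B I Dp by auto
  \<comment> \<open>The coupling matrix of \<open>standing_conditions\<close>; being nonsingular, it
    forces the error \<open>?d\<close>, which it annihilates, to vanish.\<close>
  let ?K = "?D - ?B * ?I * ?Dp"
  have K: "?K \<in> carrier_mat ?s ?s" using BID by (rule minus_carrier_mat)
  have "det ?K \<noteq> 0"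
    using standing config l by (auto simp: standing_conditions_def)
  moreover have "?K *\<^sub>v ?d = ?K *\<^sub>v 0\<^sub>v ?s"
    unfolding minus_mult_distrib_mat_vec[OF D BID d] eq
    unfolding mult_mat_vec_zero[OF K] by (rule minus_cancel_vec[OF dim_row_mult_mat_vec[OF BID]])
  ultimately have "?d = 0\<^sub>v ?s"
    using mult_mat_vec_eq_cancel[OF K _ d zero_carrier_vec] by blast
  then show ?thesis
    using minus_vec_eq_zero_iff[OF qa_carrier v] by simp
qed

section \<open>Descent through the levels\<close>

text \<open>Induction from level k+1 downwards. Peeling off S_a^l leaves S^(l+1) under
  \<open>u l\<close>, while the induction hypothesis speaks of \<open>u (Suc l)\<close>;
  \<open>next_level\<close> and \<open>u_eq\<close> bridge the two.\<close>

lemma sys_u_int_iff: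
  assumes "i \<le> Suc (nsub P)"
  shows "sys P i (q t) vel acc (u i) \<longleftrightarrow> (\<forall>j\<in>{i..Suc (nsub P)}. qa P j acc = v j)"
  using assms
proof (induction i rule: inc_induct)
  case base
  then show ?case
    using sys_last[OF vel_carrier u_carrier] sub_residual_u_int[of "Suc (nsub P)"] by simp
next
  case (step l)
  then have l: "l \<le> nsub P" by simp
  have head: "sys P l (q t) vel acc (u l) \<longleftrightarrow> qa P l acc = v l \<and> sys P (Suc l) (q t) vel acc (u l)"
    using sys_split[OF l vel_carrier acc_carrier u_carrier] sub_residual_u_int[of l] l by simp
  have next_level: "qa P (Suc l) acc = v (Suc l)" if "sys P (Suc l) (q t) vel acc (u l)"
  proof (rule sub_residual_u_int_Suc[OF l])
    show "sub_residual P (Suc l) (q t) vel acc (u l) = 0\<^sub>v (bsize P (Suc l))"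
    \<comment> \<open>Only the first block row of S^(l+1) is wanted. At level k+1 it is the whole
      system, so \<open>sys_last\<close> takes the place of \<open>sys_split\<close>.\<close>
    proof (cases "l = nsub P")
      case True
      then show ?thesis using that sys_last[OF vel_carrier u_carrier, of l] l by simp
    next
      case False
      then show ?thesis using that sys_split[OF _ vel_carrier acc_carrier u_carrier, of "Suc l" l] l by simp
    qed
  qed
  have u_eq: "u l = u (Suc l)" if "qa P (Suc l) acc = v (Suc l)"
  proof -
    have "minv (Ba P l (q t)) *\<^sub>v (Dau_part P l (Suc l) (q t) *\<^sub>v 0\<^sub>v (bsize P (Suc l)))
        = 0\<^sub>v (nact P)"
      using mult_mat_vec_zero[OF minv_Ba_carrier[OF l]] mult_mat_vec_zero[OF Dau_part_carrier[of l "Suc l"]] l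
      by simp
    then show ?thesis
      using u_int_diff[OF l] that v_carrier[of "Suc l"] u_carrier[of "Suc l"] l by simp
  qed
  have "sys P (Suc l) (q t) vel acc (u l) \<longleftrightarrow> (\<forall>j\<in>{Suc l..Suc (nsub P)}. qa P j acc = v j)"
  proof
    assume "sys P (Suc l) (q t) vel acc (u l)"
    then show "\<forall>j\<in>{Suc l..Suc (nsub P)}. qa P j acc = v j"
      using next_level u_eq step.IH by metis
  next
    \<comment> \<open>Here the controls agree directly by \<open>u_eq\<close>, since the
      acceleration of the next block is assumed.\<close>
    assume tail: "\<forall>j\<in>{Suc l..Suc (nsub P)}. qa P j acc = v j"
    then have "qa P (Suc l) acc = v (Suc l)" using l by simp
    then show "sys P (Suc l) (q t) vel acc (u l)" using u_eq step.IH tail by metis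
  qed
  moreover have "{l..Suc (nsub P)} = insert l {Suc l..Suc (nsub P)}" using l by auto
  ultimately show ?case using head by (simp only: ball_simps)
qed

end

theorem lemma1:
  fixes P :: plant and C :: design and T :: "real set" and q :: "real \<Rightarrow> real vec"
    and m i :: nat
  assumes plant: "well_formed_plant P"
    and unactuated: "m = nsub P * nact P + nlast P"
    and highly_underactuated: "nact P < m"
    and standing: "standing_conditions P"
    and design: "well_formed_design P C"
    and time: "is_interval T" "interior T \<noteq> {}"
    and trajectory: "twice_differentiable_curve T (nact P + m) q" "\<forall>t\<in>T. q t \<in> cspace P"
    and profiles: "\<forall>l\<le>nsub P + 1. twice_differentiable_curve T (bsize P l) (profile C l)"
    and balance: "balance_profiles P C T q"
    and level: "i \<le> nsub P + 1"
  shows "\<forall>t\<in>T.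
     sys P i (q t) (ddt T q t) (ddt T (ddt T q) t) (u_int P C T q i t)
     \<longleftrightarrow> (\<forall>j\<in>{i..nsub P}. qa P j (ddt T (ddt T q) t) = v_int P C T q j t)
       \<and> ql P (nsub P + 1) (ddt T (ddt T q) t) = v_int P C T q (nsub P + 1) t"
proof
  fix t assume t: "t \<in> T"
  have "profile C (nsub P + 1) t \<in> carrier_vec (bsize P (nsub P + 1))"
    using profiles t by (auto simp: twice_differentiable_curve_def)
  then interpret closed_loop P q t C T
    using plant standing design trajectory t
    by unfold_locales (auto simp: twice_differentiable_curve_def unactuated ndof_def bsize_def)
  \<comment> \<open>As i <= k+1, the last index always belongs to the range, while
    \<open>{i..nsub P}\<close> is empty for i = k+1; at that index \<open>qa\<close> is all of
    \<open>ql\<close>.\<close>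
  have "{i..Suc (nsub P)} = insert (Suc (nsub P)) {i..nsub P}" using level by auto
  then show "sys P i (q t) (ddt T q t) (ddt T (ddt T q) t) (u_int P C T q i t)
     \<longleftrightarrow> (\<forall>j\<in>{i..nsub P}. qa P j (ddt T (ddt T q) t) = v_int P C T q j t)
       \<and> ql P (nsub P + 1) (ddt T (ddt T q) t) = v_int P C T q (nsub P + 1) t"
    using sys_u_int_iff[of i] level last_level(4)[OF vel_carrier, of acc] by auto
qed

end
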